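(* Let $A\in\mathbb{R}^{m\times n}$ have no zero row and no zero column, and let $C\in\mathbb{R}^{p\times n}$. Let $X^{(0)}\in\mathbb{R}^{p\times m}$ satisfy $(X^{(0)}_{i,:})^T\in R(A)$ for $i=1,\dots,p$, let $Z^{(0)}=C^T$, and for $k\ge0$ let $$Z^{(k+1)}=Z^{(k)}-\frac{(A_{i,:})^T}{\|A_{i,:}\|_2^2}\bigl(A_{i,:}Z^{(k)}\bigr),\qquad X^{(k+1)}=X^{(k)}+\frac{C_{:,j}-(Z^{(k+1)}_{j,:})^T-X^{(k)}A_{:,j}}{\|A_{:,j}\|_2^2}(A_{:,j})^T,$$ where at each iteration the row index $i$ and the column index $j$ of $A$ are selected at random with probabilities $\|A_{i,:}\|_2^2/\|A\|_F^2$ and $\|A_{:,j}\|_2^2/\|A\|_F^2$, respectively. Then $\{X^{(k)}\}$ converges linearly in mean square to $CA^+$, and for all $k\ge0$ $$E\bigl[\|X^{(k)}-CA^+\|_F^2\bigr]\le\frac{k\rho^k}{\|A\|_F^2}\|Z^{(0)}-(I_n-A^+A)C^T\|_F^2+\rho^k\|X^{(0)}-CA^+\|_F^2,$$ where $\rho=1-\dfrac{\sigma_{\min}^2(A)}{\|A\|_F^2}$.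
   Context: $A_{i,:}$ and $A_{:,j}$ denote the $i$th row and $j$th column of $A$, $R(A)$ the column space of $A$, $A^+$ the Moore-Penrose inverse, $\|\cdot\|_F$ the Frobenius norm, $\sigma_{\min}(A)$ the smallest nonzero singular value of $A$, and $I_n$ the $n\times n$ identity. $A$ may be rank deficient and $XA=C$ may be inconsistent. All index selections (row and column, and over different iterations) are independent. "Converges linearly in mean square to $X^*$" means that $E[\|X^{(k)}-X^*\|_F^2]\to 0$ at a geometric rate (bounded by $c\,q^k$ for some $c\ge 0$ and $q\in[0,1)$). *)

theory Defs
  imports "HOL-Probability.Probability"
begin

text \<open>
  A matrix with \<^term>\<open>m\<close> rows and \<^term>\<open>n\<close> columns has type \<^typ>\<open>real^'n^'m\<close>. The library norm of
  this type is the Euclidean norm of the vector of row norms, that is, the Frobenius norm.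
\<close>

definition is_moore_penrose :: "real^'n^'m \<Rightarrow> real^'m^'n \<Rightarrow> bool" where
  "is_moore_penrose A G \<longleftrightarrow>
     A ** G ** A = A \<and>
     G ** A ** G = G \<and>
     transpose (A ** G) = A ** G \<and>
     transpose (G ** A) = G ** A"

definition moore_penrose :: "real^'n^'m \<Rightarrow> real^'m^'n" where
  "moore_penrose A = (THE G. is_moore_penrose A G)"

lemma is_moore_penrose_unique:
  assumes "is_moore_penrose A G" "is_moore_penrose A H"
  shows "G = H"
proof -
  have AG: "A ** G = A ** H"
  proof -
    have "A ** G = transpose (A ** G)"
      using assms(1) by (simp add: is_moore_penrose_def)
    also have "\<dots> = transpose ((A ** H) ** (A ** G))"
      using assms(2) by (simp add: is_moore_penrose_def matrix_mul_assoc)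
    also have "\<dots> = transpose (A ** G) ** transpose (A ** H)"
      by (rule matrix_transpose_mul)
    also have "\<dots> = (A ** G) ** (A ** H)"
      using assms by (simp add: is_moore_penrose_def)
    also have "\<dots> = A ** H"
      using assms(1) by (simp add: is_moore_penrose_def matrix_mul_assoc)
    finally show ?thesis .
  qed
  have GA: "G ** A = H ** A"
  proof -
    have "G ** A = transpose (G ** A)"
      using assms(1) by (simp add: is_moore_penrose_def)
    also have "\<dots> = transpose ((G ** A) ** (H ** A))"
      using assms(2) by (metis is_moore_penrose_def matrix_mul_assoc)
    also have "\<dots> = transpose (H ** A) ** transpose (G ** A)"
      by (rule matrix_transpose_mul)
    also have "\<dots> = (H ** A) ** (G ** A)"
      using assms by (simp add: is_moore_penrose_def)
    also have "\<dots> = H ** A"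
      using assms(1) by (metis is_moore_penrose_def matrix_mul_assoc)
    finally show ?thesis .
  qed
  have "G = G ** A ** G"
    using assms(1) by (simp add: is_moore_penrose_def)
  also have "\<dots> = H ** A ** H"
    by (metis AG GA matrix_mul_assoc)
  also have "\<dots> = H"
    using assms(2) by (simp add: is_moore_penrose_def)
  finally show ?thesis .
qed

text \<open>
  The singular values are the square roots of the eigenvalues of \<^term>\<open>transpose A ** A\<close>. The nonzero
  ones do not change if \<^term>\<open>A ** transpose A\<close> is used instead.
\<close>

definition singular_value :: "real^'n^'m \<Rightarrow> real \<Rightarrow> bool" where
  "singular_value A s \<longleftrightarrow>
     0 \<le> s \<and> (\<exists>v. v \<noteq> 0 \<and> (transpose A ** A) *v v = s\<^sup>2 *\<^sub>R v)"

definition sigma_min :: "real^'n^'m \<Rightarrow> real" where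
  "sigma_min A = (LEAST s. singular_value A s \<and> s \<noteq> 0)"

definition outer :: "real^'m \<Rightarrow> real^'n \<Rightarrow> real^'n^'m" where
  "outer u v = (\<chi> a b. u $ a * v $ b)"

definition Z_step :: "real^'n^'m \<Rightarrow> 'm \<Rightarrow> real^'p^'n \<Rightarrow> real^'p^'n" where
  "Z_step A i Z = Z - outer ((1 / (norm (row i A))\<^sup>2) *\<^sub>R row i A) (row i A v* Z)"

text \<open>The argument \<^term>\<open>Z\<close> below is the already updated iterate.\<close>

definition X_step ::
    "real^'n^'m \<Rightarrow> real^'n^'p \<Rightarrow> 'n \<Rightarrow> real^'p^'n \<Rightarrow> real^'m^'p \<Rightarrow> real^'m^'p" where
  "X_step A C j Z X =
     X + outer ((1 / (norm (column j A))\<^sup>2) *\<^sub>R (column j C - row j Z - X *v column j A))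
               (column j A)"

text \<open>
  The integrability requirement is there because the Bochner integral of a non-integrable function
  is 0 by convention.
\<close>

definition converges_linearly_in_mean_square ::
    "'w measure \<Rightarrow> (nat \<Rightarrow> 'w \<Rightarrow> real^'m^'p) \<Rightarrow> real^'m^'p \<Rightarrow> bool" where
  "converges_linearly_in_mean_square M X L \<longleftrightarrow>
     (\<forall>k. integrable M (\<lambda>\<omega>. (norm (X k \<omega> - L))\<^sup>2)) \<and>
     (\<exists>c q. 0 \<le> c \<and> 0 \<le> q \<and> q < 1 \<and>
        (\<forall>k. prob_space.expectation M (\<lambda>\<omega>. (norm (X k \<omega> - L))\<^sup>2) \<le> c * q ^ k))"

text \<open>
  Row and column indices have different types; the injections into the sum type put all of them, of
  all iterations, into a single mutually independent family.
\<close>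

definition independent_selections ::
    "'w measure \<Rightarrow> (nat \<Rightarrow> 'w \<Rightarrow> 'm) \<Rightarrow> (nat \<Rightarrow> 'w \<Rightarrow> 'n) \<Rightarrow> bool" where
  "independent_selections M I J \<longleftrightarrow>
     prob_space.indep_vars M (\<lambda>_. count_space (UNIV :: ('m + 'n) set))
       (case_sum (\<lambda>k \<omega>. Inl (I k \<omega>)) (\<lambda>k \<omega>. Inr (J k \<omega>))) (UNIV :: (nat + nat) set)"

end

theory Submission
  imports Defs
begin

text \<open>
  Put \<open>G = A\<^sup>+\<close>, \<open>Zs = (I - G A) C\<^sup>T\<close> and \<open>Xs = C G\<close>, so that \<open>A Zs = 0\<close> and \<open>C = Xs A + Zs\<^sup>T\<close>.
  The columns of \<open>W = Z - Zs\<close> stay in the row space of \<open>A\<close> and the rows of \<open>D = X - Xs\<close> in its column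
  space; on these spaces multiplication by \<open>A\<close> stretches by at least the smallest nonzero singular value.
  A row step is an orthogonal projection of \<open>W\<close>, and a column step with column \<open>a\<close> moves \<open>D\<close> to
  \<open>D (I - a a\<^sup>T / |a|\<^sup>2) - w a\<^sup>T / |a|\<^sup>2\<close>, where \<open>w\<close> is a row of the new \<open>W\<close>; the two summands are
  orthogonal. Averaging with the given probabilities yields
  \<open>E |W'|\<^sup>2 \<le> \<rho> E |W|\<^sup>2\<close> and \<open>E |D'|\<^sup>2 \<le> \<rho> E |D|\<^sup>2 + E |W'|\<^sup>2 / |A|\<^sup>2\<close>, and the bound follows by
  induction.
\<close>

section \<open>The Moore-Penrose inverse and the smallest singular value\<close>

text \<open>If \<open>A^T A v = 0\<close>, then \<open>|A v|^2 = (A^T A v) \<bullet> v = 0\<close>.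
  This is used for every \<open>v = (B - D) x\<close>.\<close>

lemma transpose_mult_cancel_left:
  fixes A :: "real^'n^'m"
  assumes "transpose A ** A ** B = transpose A ** A ** D"
  shows "A ** B = A ** D"
proof -
  have "A *v (B *v x - D *v x) = 0" for x
  proof -
    let ?v = "B *v x - D *v x"
    have "transpose A ** A *v ?v = 0"
      by (metis assms eq_iff_diff_eq_0 matrix_vector_mul_assoc matrix_vector_mult_diff_distrib)
    then have "(A *v ?v) v* A = 0"
      by (metis matrix_vector_mul_assoc transpose_matrix_vector)
    then have "(A *v ?v) \<bullet> (A *v ?v) = 0"
      by (metis dot_lmul_matrix inner_zero_left)
    then show ?thesis by simp
  qed
  then show ?thesis
    by (simp add: matrix_eq matrix_vector_mult_diff_distrib flip: matrix_vector_mul_assoc)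
qed

text \<open>A linear right inverse of \<open>A\<close> on its range undoes \<open>A\<close> up to
  the kernel, which is all a generalized inverse has to do; no symmetry is asked for yet.\<close>

lemma generalized_inverse_exists:
  fixes A :: "real^'n^'m"
  obtains G where "A ** G ** A = A"
proof -
  obtain g where g: "linear g" "\<forall>v\<in>range ((*v) A). A *v g v = v"
    using linear_exists_right_inverse_on[of "(*v) A" UNIV] by auto
  have "A ** matrix g ** A = A"
    using g by (simp add: matrix_eq matrix_works flip: matrix_vector_mul_assoc)
  then show ?thesis ..
qed

text \<open>The candidate is \<open>A^T S A^T\<close> with \<open>S\<close> any generalized inverse
  of \<open>T = A^T A A^T\<close>. Cancelling factors in \<open>T S T = T\<close> gives
  \<open>G A A^T = A^T\<close> and \<open>A^T A G = A^T\<close>, from which all four Penrose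
  equations follow.\<close>

lemma moore_penrose_exists:
  fixes A :: "real^'n^'m"
  shows "\<exists>G. is_moore_penrose A G"
proof -
  define T where "T = transpose A ** A ** transpose A"
  obtain S where S: "T ** S ** T = T"
    using generalized_inverse_exists .
  define G where "G = transpose A ** S ** transpose A"
  have "transpose A ** A ** (transpose A ** S ** T) = transpose A ** A ** transpose A"
    using S by (simp add: T_def matrix_mul_assoc)
  then have "A ** (transpose A ** S ** T) = A ** transpose A"
    by (rule transpose_mult_cancel_left)
  then have "transpose (transpose A) ** transpose A ** (S ** T) = transpose (transpose A) ** transpose A ** mat 1"
    by (simp add: matrix_mul_assoc)
  then have "transpose A ** (S ** T) = transpose A ** mat 1"
    by (rule transpose_mult_cancel_left)
  then have left: "transpose A ** S ** T = transpose A"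
    by (simp add: matrix_mul_assoc)
  \<comment> \<open>The same cancellation is run on the transposed equation, where \<open>A\<close>
    and \<open>A^T\<close> exchange roles.\<close>
  have "transpose T ** transpose S ** transpose T = transpose T"
    by (metis S matrix_transpose_mul matrix_mul_assoc)
  then have "transpose (transpose A) ** transpose A ** (A ** transpose S ** transpose T)
      = transpose (transpose A) ** transpose A ** A"
    by (simp add: T_def matrix_transpose_mul matrix_mul_assoc)
  then have "transpose A ** (A ** transpose S ** transpose T) = transpose A ** A"
    by (rule transpose_mult_cancel_left)
  then have "transpose A ** A ** (transpose S ** transpose T) = transpose A ** A ** mat 1"
    by (simp add: matrix_mul_assoc)
  then have "A ** (transpose S ** transpose T) = A ** mat 1"
    by (rule transpose_mult_cancel_left)
  then have right: "T ** S ** transpose A = transpose A"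
    by (metis matrix_transpose_mul matrix_mul_assoc matrix_mul_rid transpose_transpose)
  have GAA: "(G ** A) ** transpose A = transpose A"
    using left by (simp add: G_def T_def matrix_mul_assoc)
  have AAG: "transpose A ** (A ** G) = transpose A"
    using right by (simp add: G_def T_def matrix_mul_assoc)
  \<comment> \<open>A matrix \<open>B\<close> with \<open>B B^T = B^T\<close> is symmetric, because
    \<open>B B^T\<close> is; the argument for \<open>A ** G\<close> is the mirror image.\<close>
  have GA: "transpose (G ** A) = G ** A"
  proof -
    have "(G ** A) ** transpose (G ** A) = transpose (G ** A)"
      using GAA by (simp add: matrix_transpose_mul matrix_mul_assoc)
    then show ?thesis
      by (metis matrix_transpose_mul transpose_transpose)
  qed
  have AG: "transpose (A ** G) = A ** G"
  proof -
    have "transpose (A ** G) ** (A ** G) = transpose (A ** G)"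
      using AAG by (metis matrix_transpose_mul matrix_mul_assoc)
    then show ?thesis
      by (metis matrix_transpose_mul transpose_transpose)
  qed
  have "A ** G ** A = A"
    by (metis GA GAA matrix_transpose_mul matrix_mul_assoc transpose_transpose)
  moreover have "G ** A ** G = G"
    using GAA by (simp add: G_def matrix_mul_assoc)
  ultimately show ?thesis
    using GA AG is_moore_penrose_def by blast
qed

lemma moore_penrose:
  fixes A :: "real^'n^'m"
  shows "is_moore_penrose A (moore_penrose A)"
  unfolding moore_penrose_def
  by (metis is_moore_penrose_unique moore_penrose_exists theI')

lemmas moore_penrose_identities = moore_penrose[unfolded is_moore_penrose_def]

text \<open>For \<open>s \<noteq> 0\<close> the eigenvector equals \<open>A^T (A v) / s^2\<close>,
  so it lies in the row space, where \<open>A^+ A\<close> acts as the identity. This makes every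
  nonzero singular value comparable with the minimum of \<open>|A v|\<close> over unit vectors of
  that space.\<close>

lemma singular_value_attained:
  fixes A :: "real^'n^'m"
  assumes "singular_value A s" "s \<noteq> 0"
  obtains v where "norm v = 1" "moore_penrose A ** A *v v = v" "norm (A *v v) = s"
proof -
  from assms obtain u where s: "0 \<le> s" and u: "u \<noteq> 0" "(transpose A ** A) *v u = s\<^sup>2 *\<^sub>R u"
    unfolding singular_value_def by blast
  define v where "v = u /\<^sub>R norm u"
  have v: "norm v = 1" "(transpose A ** A) *v v = s\<^sup>2 *\<^sub>R v"
    using u by (auto simp: v_def matrix_vector_mult_scaleR)
  have "moore_penrose A ** A ** transpose A = transpose A"
    by (metis moore_penrose_identities matrix_transpose_mul matrix_mul_assoc)
  then have "moore_penrose A ** A *v (s\<^sup>2 *\<^sub>R v) = s\<^sup>2 *\<^sub>R v"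
    by (metis v(2) matrix_mul_assoc matrix_vector_mul_assoc)
  then have fixed: "moore_penrose A ** A *v v = v"
    using assms(2) by (simp add: matrix_vector_mult_scaleR)
  have "(norm (A *v v))\<^sup>2 = ((transpose A ** A) *v v) \<bullet> v"
    by (simp add: power2_norm_eq_inner dot_lmul_matrix flip: matrix_vector_mul_assoc)
  also have "\<dots> = s\<^sup>2"
    using v by (simp add: norm_eq_1)
  finally have "norm (A *v v) = s"
    using s by simp
  with v(1) fixed show ?thesis ..
qed

text \<open>\<open>A^+ A\<close> projects onto the row space. By compactness \<open>|A v|\<close>
  has a minimum \<open>s\<close> on the unit sphere there, positive since \<open>A\<close> is
  injective on that space. The minimizer is an eigenvector, so \<open>s\<close> is a singular value,
  and any other nonzero one is attained on the same sphere; hence the \<open>LEAST\<close> exists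
  and equals \<open>s\<close>.\<close>

lemma sigma_min_characterization:
  fixes A :: "real^'n^'m"
  assumes "A \<noteq> 0"
  shows "0 < sigma_min A"
    and "moore_penrose A ** A *v v = v \<Longrightarrow> sigma_min A * norm v \<le> norm (A *v v)"
proof -
  define P where "P = moore_penrose A ** A"
  have AP: "A ** P = A" and PP: "P ** P = P" and Psym: "transpose P = P"
    unfolding P_def by (metis moore_penrose_identities matrix_mul_assoc)+
  have kernel: "v = 0" if "P *v v = v" "A *v v = 0" for v
    using that by (metis P_def matrix_vector_mul_assoc matrix_vector_mult_0_right)
  define K where "K = {v. norm v = 1 \<and> P *v v = v}"
  have closed: "closed {v. P *v v = v}"
    by (intro closed_Collect_eq continuous_intros linear_continuous_on)
       (auto simp: linear_linear)
  have "compact K"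
  proof -
    have "K = sphere 0 1 \<inter> {v. P *v v = v}"
      by (auto simp: K_def)
    then show ?thesis
      using closed by (simp add: compact_Int_closed)
  qed
  moreover have "K \<noteq> {}"
  proof -
    have "P \<noteq> 0"
      using assms AP by auto
    then obtain x where x: "P *v x \<noteq> 0"
      by (metis matrix_eq matrix_vector_mult_0)
    have "P *v (P *v x /\<^sub>R norm (P *v x)) = P *v x /\<^sub>R norm (P *v x)"
      by (simp add: matrix_vector_mult_scaleR matrix_vector_mul_assoc PP)
    with x have "P *v x /\<^sub>R norm (P *v x) \<in> K"
      by (simp add: K_def)
    then show ?thesis by blast
  qed
  moreover have "continuous_on K (\<lambda>v. norm (A *v v))"
    by (intro continuous_intros linear_continuous_on) (auto simp: linear_linear)
  ultimately obtain u where u: "u \<in> K" and min: "\<And>v. v \<in> K \<Longrightarrow> norm (A *v u) \<le> norm (A *v v)"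
    using continuous_attains_inf[of K] by blast
  define s where "s = norm (A *v u)"
  have norm_u: "norm u = 1" and Pu: "P *v u = u"
    using u by (auto simp: K_def)
  have "s > 0"
    using kernel[OF Pu] norm_u by (auto simp: s_def)
  have bound: "s * norm v \<le> norm (A *v v)" if "P *v v = v" for v
  proof (cases "v = 0")
    case False
    then have "v /\<^sub>R norm v \<in> K"
      using that by (simp add: K_def matrix_vector_mult_scaleR)
    from min[OF this] False show ?thesis
      by (simp add: s_def matrix_vector_mult_scaleR field_simps)
  qed simp
  text \<open>The minimizer is an eigenvector: the quadratic form is nonnegative on the row space and
    vanishes at \<open>u\<close>, so its gradient \<open>r\<close>, which lies in the row space, is zero.\<close>
  define r where "r = (transpose A ** A) *v u - s\<^sup>2 *\<^sub>R u"
  have Pr: "P *v r = r"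
  proof -
    have "P ** transpose A = transpose A"
      by (metis AP Psym matrix_transpose_mul)
    then show ?thesis
      by (simp add: r_def matrix_vector_mult_diff_distrib matrix_vector_mult_scaleR Pu
          matrix_vector_mul_assoc matrix_mul_assoc del: transpose_matrix_vector)
  qed
  have cross: "(A *v u) \<bullet> (A *v r) - s\<^sup>2 * (u \<bullet> r) = r \<bullet> r"
  proof -
    have "(A *v u) \<bullet> (A *v r) = ((transpose A ** A) *v u) \<bullet> r"
      by (simp add: dot_lmul_matrix flip: matrix_vector_mul_assoc)
    then show ?thesis
      by (simp add: r_def inner_diff_left)
  qed
  \<comment> \<open>This is the square of \<open>bound\<close> at \<open>u + t r\<close>: the
    constant terms cancel, and \<open>cross\<close> identifies the linear coefficient.\<close>
  have quad: "0 \<le> 2 * t * (r \<bullet> r) + t\<^sup>2 * ((norm (A *v r))\<^sup>2 - s\<^sup>2 * (norm r)\<^sup>2)" for t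
  proof -
    have "P *v (u + t *\<^sub>R r) = u + t *\<^sub>R r"
      by (simp add: matrix_vector_right_distrib matrix_vector_mult_scaleR Pu Pr)
    from bound[OF this] have "(s * norm (u + t *\<^sub>R r))\<^sup>2 \<le> (norm (A *v (u + t *\<^sub>R r)))\<^sup>2"
      using \<open>s > 0\<close> by (intro power_mono) auto
    then have "s\<^sup>2 * (norm (u + t *\<^sub>R r))\<^sup>2 \<le> (norm (A *v u + t *\<^sub>R (A *v r)))\<^sup>2"
      by (simp add: power_mult_distrib matrix_vector_right_distrib matrix_vector_mult_scaleR)
    also have "s\<^sup>2 * (norm (u + t *\<^sub>R r))\<^sup>2 = s\<^sup>2 + 2 * t * s\<^sup>2 * (u \<bullet> r) + t\<^sup>2 * s\<^sup>2 * (norm r)\<^sup>2"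
      using norm_u unfolding power2_norm_eq_inner norm_eq_1
      by (simp add: inner_add_left inner_add_right inner_commute algebra_simps power2_eq_square)
    also have "(norm (A *v u + t *\<^sub>R (A *v r)))\<^sup>2
        = s\<^sup>2 + 2 * t * ((A *v u) \<bullet> (A *v r)) + t\<^sup>2 * (norm (A *v r))\<^sup>2"
      unfolding power2_norm_eq_inner s_def
      by (simp add: inner_add_left inner_add_right inner_commute algebra_simps power2_eq_square)
    finally show ?thesis
      unfolding cross[symmetric] by (simp add: algebra_simps)
  qed
  have "r = 0"
  proof (rule ccontr)
    assume "r \<noteq> 0"
    define c where "c = (norm (A *v r))\<^sup>2 - s\<^sup>2 * (norm r)\<^sup>2"
    have c: "c \<ge> 0"
      using power_mono[OF bound[OF Pr], of 2] \<open>s > 0\<close> by (simp add: c_def power_mult_distrib)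
    \<comment> \<open>A negative step so short that the linear term outweighs \<open>t^2 c\<close>;
      adding 1 keeps the denominator positive when \<open>c = 0\<close>.\<close>
    define t where "t = - (r \<bullet> r) / (c + 1)"
    have "2 * t * (r \<bullet> r) + t\<^sup>2 * c = t * (2 * (r \<bullet> r) + t * c)"
      by (simp add: algebra_simps power2_eq_square)
    also have "\<dots> < 0"
    proof (rule mult_neg_pos)
      show "t < 0"
        using c \<open>r \<noteq> 0\<close> by (simp add: t_def divide_neg_pos)
      have "- (t * c) \<le> r \<bullet> r"
        using c by (simp add: t_def field_simps)
      moreover have "0 < r \<bullet> r"
        using \<open>r \<noteq> 0\<close> by simp
      ultimately show "0 < 2 * (r \<bullet> r) + t * c"
        by linarith
    qed
    finally have "2 * t * (r \<bullet> r) + t\<^sup>2 * c < 0" .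
    with quad[of t] show False
      by (simp add: c_def)
  qed
  then have "singular_value A s"
    using \<open>s > 0\<close> norm_u unfolding singular_value_def r_def
    by (metis eq_iff_diff_eq_0 less_eq_real_def norm_zero zero_neq_one)
  moreover have "s \<le> s'" if "singular_value A s'" "s' \<noteq> 0" for s'
    using singular_value_attained[OF that] bound unfolding P_def by (metis mult.right_neutral)
  ultimately have "sigma_min A = s"
    unfolding sigma_min_def using \<open>s > 0\<close> by (intro Least_equality) auto
  then show "0 < sigma_min A"
    and "moore_penrose A ** A *v v = v \<Longrightarrow> sigma_min A * norm v \<le> norm (A *v v)"
    using \<open>s > 0\<close> bound by (auto simp: P_def)
qed

text \<open>Write \<open>u = A v\<close> with \<open>v = A^+ u\<close> in the row space. Then
  \<open>|u|^2 = (A^T u) \<bullet> v \<le> |A^T u| |v|\<close>, while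
  \<open>sigma_min A * |v| \<le> |u|\<close>; multiplying the two and cancelling \<open>|u|\<close>
  gives the claim.\<close>

lemma sigma_min_le_transpose:
  fixes A :: "real^'n^'m"
  assumes "A \<noteq> 0" "A ** moore_penrose A *v u = u"
  shows "sigma_min A * norm u \<le> norm (u v* A)"
proof (cases "u = 0")
  case False
  define v where "v = moore_penrose A *v u"
  have Av: "A *v v = u"
    using assms(2) by (simp add: v_def matrix_vector_mul_assoc)
  have "moore_penrose A ** A *v v = v"
    by (simp add: v_def matrix_vector_mul_assoc moore_penrose_identities)
  from sigma_min_characterization(2)[OF assms(1) this] have "sigma_min A * norm v \<le> norm u"
    by (simp add: Av)
  then have "(sigma_min A * norm v) * norm (u v* A) \<le> norm u * norm (u v* A)"
    by (intro mult_right_mono) auto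
  moreover have "norm u * norm u = (u v* A) \<bullet> v"
    using Av by (simp add: dot_lmul_matrix power2_norm_eq_inner flip: power2_eq_square)
  then have "norm u * norm u \<le> norm (u v* A) * norm v"
    by (simp add: norm_cauchy_schwarz)
  then have "sigma_min A * (norm u * norm u) \<le> sigma_min A * (norm (u v* A) * norm v)"
    using sigma_min_characterization(1)[OF assms(1)] by (intro mult_left_mono) auto
  ultimately have "norm u * (sigma_min A * norm u) \<le> norm u * norm (u v* A)"
    by (simp add: algebra_simps)
  with False show ?thesis by simp
qed simp

section \<open>One row or column step\<close>

lemma norm_vec_power2: "(norm (x :: 'a::real_normed_vector^'n))\<^sup>2 = (\<Sum>i\<in>UNIV. (norm (x $ i))\<^sup>2)"
  by (simp add: norm_vec_def L2_set_def sum_nonneg)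

lemma norm_matrix_power2_rows:
  "(norm (A :: real^'n^'m))\<^sup>2 = (\<Sum>i\<in>UNIV. (norm (row i A))\<^sup>2)"
  by (simp add: norm_vec_power2 row_def vec_nth_inverse)

lemma norm_matrix_power2_columns:
  "(norm (A :: real^'n^'m))\<^sup>2 = (\<Sum>j\<in>UNIV. (norm (column j A))\<^sup>2)"
  unfolding norm_vec_power2 column_def by (subst sum.swap) simp

lemma row_matrix_mult: "row i (A ** B) = row i A v* B"
  by (simp add: row_def matrix_matrix_mult_def vector_matrix_mult_def vec_eq_iff mult.commute)

lemma column_matrix_mult: "column j (A ** B) = A *v column j B"
  by (simp add: column_def matrix_matrix_mult_def matrix_vector_mult_def vec_eq_iff)

lemma sigma_min_le_frobenius_left:
  fixes A :: "real^'n^'m" and W :: "real^'p^'n"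
  assumes "A \<noteq> 0" "moore_penrose A ** A ** W = W"
  shows "(sigma_min A)\<^sup>2 * (norm W)\<^sup>2 \<le> (norm (A ** W))\<^sup>2"
proof -
  have "sigma_min A * norm (column c W) \<le> norm (column c (A ** W))" for c
    using sigma_min_characterization(2)[OF assms(1), of "column c W"] assms(2)
    by (metis column_matrix_mult)
  then have "(sigma_min A)\<^sup>2 * (norm (column c W))\<^sup>2 \<le> (norm (column c (A ** W)))\<^sup>2" for c
    using sigma_min_characterization(1)[OF assms(1)]
    by (metis power_mono power_mult_distrib mult_nonneg_nonneg norm_ge_zero less_imp_le)
  then show ?thesis
    unfolding norm_matrix_power2_columns sum_distrib_left by (intro sum_mono)
qed

lemma sigma_min_le_frobenius_right:
  fixes A :: "real^'n^'m" and D :: "real^'m^'p"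
  assumes "A \<noteq> 0" "D ** (A ** moore_penrose A) = D"
  shows "(sigma_min A)\<^sup>2 * (norm D)\<^sup>2 \<le> (norm (D ** A))\<^sup>2"
proof -
  have "A ** moore_penrose A *v row r D = row r D" for r
    by (metis assms(2) moore_penrose_identities row_matrix_mult transpose_matrix_vector)
  then have "sigma_min A * norm (row r D) \<le> norm (row r (D ** A))" for r
    using sigma_min_le_transpose[OF assms(1)] by (simp add: row_matrix_mult)
  then have "(sigma_min A)\<^sup>2 * (norm (row r D))\<^sup>2 \<le> (norm (row r (D ** A)))\<^sup>2" for r
    using sigma_min_characterization(1)[OF assms(1)]
    by (metis power_mono power_mult_distrib mult_nonneg_nonneg norm_ge_zero less_imp_le)
  then show ?thesis
    unfolding norm_matrix_power2_rows[of D] norm_matrix_power2_rows[of "D ** A"] sum_distrib_left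
    by (intro sum_mono)
qed

section \<open>Rank-one updates\<close>

lemma inner_outer: "W \<bullet> outer u v = u \<bullet> (W *v v)"
  by (simp add: inner_vec_def outer_def matrix_vector_mult_def sum_distrib_left algebra_simps)

lemma outer_vector_mult: "outer u v *v x = (v \<bullet> x) *\<^sub>R u"
  by (simp add: outer_def matrix_vector_mult_def inner_vec_def vec_eq_iff
      sum_distrib_right sum_distrib_left algebra_simps)

text \<open>Both kinds of step add a rank-one matrix to the error, so this expansion of the square
  yields both error identities.\<close>

lemma norm_add_outer_power2:
  "(norm (W + outer u v))\<^sup>2 = (norm W)\<^sup>2 + 2 * (u \<bullet> (W *v v)) + (norm u)\<^sup>2 * (norm v)\<^sup>2"
proof -
  have "outer u v \<bullet> outer u v = (norm u)\<^sup>2 * (norm v)\<^sup>2"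
    by (simp add: inner_outer outer_vector_mult power2_norm_eq_inner)
  then show ?thesis
    unfolding power2_norm_eq_inner[of "_ + _"] power2_norm_eq_inner[of W]
    by (simp add: inner_add_left inner_add_right inner_commute[of "outer u v" W] inner_outer
        matrix_vector_mult_add_rdistrib)
qed

lemma outer_matrix_mult: "outer u v ** B = outer u (v v* B)"
  by (simp add: outer_def matrix_matrix_mult_def vector_matrix_mult_def vec_eq_iff
      sum_distrib_left algebra_simps)

lemma matrix_outer_mult: "B ** outer u v = outer (B *v u) v"
  by (simp add: outer_def matrix_matrix_mult_def matrix_vector_mult_def vec_eq_iff
      sum_distrib_left algebra_simps)

lemma outer_minus_left: "outer (- u) v = - outer u v"
  by (simp add: outer_def vec_eq_iff)

lemma matrix_diff_ldistrib: "(A :: 'a::ring_1^'n^'m) ** (B - D) = A ** B - A ** D"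
  by (simp add: matrix_matrix_mult_def vec_eq_iff right_diff_distrib sum_subtractf)

lemma matrix_add_rdistrib: "((A :: 'a::semiring_1^'n^'m) + B) ** D = A ** D + B ** D"
  by (simp add: matrix_matrix_mult_def vec_eq_iff distrib_right sum.distrib)

lemma matrix_diff_rdistrib: "((A :: 'a::ring_1^'n^'m) - B) ** D = A ** D - B ** D"
  by (simp add: matrix_matrix_mult_def vec_eq_iff left_diff_distrib sum_subtractf)

section \<open>The row step\<close>

lemma Z_step_fixed:
  fixes A :: "real^'n^'m" and Z Zs :: "real^'p^'n"
  assumes "moore_penrose A ** A ** (Z - Zs) = Z - Zs"
  shows "moore_penrose A ** A ** (Z_step A i Z - Zs) = Z_step A i Z - Zs"
proof -
  let ?P = "moore_penrose A ** A"
  have "?P ** transpose A = transpose A"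
    by (metis moore_penrose_identities matrix_transpose_mul matrix_mul_assoc)
  \<comment> \<open>A row of \<open>A\<close> is a column of \<open>A^T\<close>, hence fixed by the
    projector; so is any update whose left factor is a multiple of it.\<close>
  then have "?P *v row i A = row i A"
    by (metis column_matrix_mult column_transpose)
  then have "?P ** outer (c *\<^sub>R row i A) v = outer (c *\<^sub>R row i A) v" for c and v :: "real^'p"
    by (simp add: matrix_outer_mult matrix_vector_mult_scaleR)
  moreover have "Z_step A i Z - Zs
      = (Z - Zs) - outer ((1 / (norm (row i A))\<^sup>2) *\<^sub>R row i A) (row i A v* Z)"
    by (simp add: Z_step_def)
  ultimately show ?thesis
    using assms by (simp add: matrix_diff_ldistrib)
qed

text \<open>Since \<open>A ** Zs = 0\<close>, the step acts on \<open>W = Z - Zs\<close> alone and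
  removes from each column its component along the row \<open>a\<close>; this is Pythagoras. The
  factor \<open>|a|^2\<close> anticipates the selection probability.\<close>

lemma Z_step_error:
  fixes A :: "real^'n^'m" and Z Zs :: "real^'p^'n"
  assumes "row i A \<noteq> 0" "A ** Zs = 0"
  shows "(norm (row i A))\<^sup>2 * (norm (Z_step A i Z - Zs))\<^sup>2
    = (norm (row i A))\<^sup>2 * (norm (Z - Zs))\<^sup>2 - (norm (row i (A ** (Z - Zs))))\<^sup>2"
proof -
  define a where "a = row i A"
  define W where "W = Z - Zs"
  define v where "v = a v* W"
  have "a v* Zs = 0"
    by (simp add: a_def assms(2) row_matrix_mult[symmetric]) (simp add: row_def vec_eq_iff)
  then have "a v* Z = v"
    by (simp add: v_def W_def vector_matrix_mult_diff_rdistrib)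
  then have "Z_step A i Z - Zs = W + outer (- ((1 / (norm a)\<^sup>2) *\<^sub>R a)) v"
    by (simp add: Z_step_def W_def a_def outer_minus_left)
  then have "(norm (Z_step A i Z - Zs))\<^sup>2
      = (norm W)\<^sup>2 - 2 * (a \<bullet> (W *v v)) / (norm a)\<^sup>2 + (norm a / (norm a)\<^sup>2)\<^sup>2 * (norm v)\<^sup>2"
    by (simp add: norm_add_outer_power2)
  also have "a \<bullet> (W *v v) = (norm v)\<^sup>2"
    by (metis v_def dot_lmul_matrix power2_norm_eq_inner)
  finally show ?thesis
    using assms(1) by (simp add: row_matrix_mult a_def W_def v_def field_simps power2_eq_square)
qed

text \<open>The probabilities cancel the denominators of the steps, so the losses add up to
  \<open>|A W|^2 / |A|^2\<close> with \<open>W = Z - Zs\<close>, which the smallest singular value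
  bounds from below.\<close>

lemma Z_step_mean_error_le:
  fixes A :: "real^'n^'m" and Z Zs :: "real^'p^'n"
  assumes "\<And>i. row i A \<noteq> 0" "A \<noteq> 0" "A ** Zs = 0" "moore_penrose A ** A ** (Z - Zs) = Z - Zs"
  shows "(\<Sum>i\<in>UNIV. (norm (row i A))\<^sup>2 / (norm A)\<^sup>2 * (norm (Z_step A i Z - Zs))\<^sup>2)
    \<le> (1 - (sigma_min A)\<^sup>2 / (norm A)\<^sup>2) * (norm (Z - Zs))\<^sup>2"
proof -
  have "(\<Sum>i\<in>UNIV. (norm (row i A))\<^sup>2 * (norm (Z_step A i Z - Zs))\<^sup>2)
      = (norm A)\<^sup>2 * (norm (Z - Zs))\<^sup>2 - (norm (A ** (Z - Zs)))\<^sup>2"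
    unfolding norm_matrix_power2_rows[of A] norm_matrix_power2_rows[of "A ** _"]
    by (simp add: Z_step_error assms(1,3) sum_subtractf sum_distrib_right)
  also have "\<dots> \<le> ((norm A)\<^sup>2 - (sigma_min A)\<^sup>2) * (norm (Z - Zs))\<^sup>2"
    using sigma_min_le_frobenius_left[OF assms(2,4)] by (simp add: algebra_simps)
  finally have "(\<Sum>i\<in>UNIV. (norm (row i A))\<^sup>2 * (norm (Z_step A i Z - Zs))\<^sup>2) / (norm A)\<^sup>2
      \<le> ((norm A)\<^sup>2 - (sigma_min A)\<^sup>2) * (norm (Z - Zs))\<^sup>2 / (norm A)\<^sup>2"
    by (rule divide_right_mono) simp
  with assms(2) show ?thesis
    by (simp add: sum_divide_distrib field_simps)
qed

text \<open>The mean-error estimate at \<open>Z = A^+ A\<close>, \<open>Zs = 0\<close> bounds a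
  nonnegative sum by the factor times \<open>|A^+ A|^2 > 0\<close>.\<close>

lemma sigma_min_le_norm:
  fixes A :: "real^'n^'m"
  assumes "\<And>i. row i A \<noteq> 0" "A \<noteq> 0"
  shows "0 \<le> 1 - (sigma_min A)\<^sup>2 / (norm A)\<^sup>2"
proof -
  let ?P = "moore_penrose A ** A"
  have "?P \<noteq> 0"
    using assms(2) by (metis moore_penrose_identities matrix_mul_assoc times0_right)
  have "0 \<le> (\<Sum>i\<in>UNIV. (norm (row i A))\<^sup>2 / (norm A)\<^sup>2 * (norm (Z_step A i ?P - 0))\<^sup>2)"
    by (intro sum_nonneg) simp
  also have "\<dots> \<le> (1 - (sigma_min A)\<^sup>2 / (norm A)\<^sup>2) * (norm (?P - 0))\<^sup>2"
    using assms moore_penrose_identities[of A]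
    by (intro Z_step_mean_error_le) (simp_all add: matrix_mul_assoc)
  finally show ?thesis
    using \<open>?P \<noteq> 0\<close> by (simp add: zero_le_mult_iff)
qed

section \<open>The column step\<close>

lemma X_step_diff:
  fixes A :: "real^'n^'m" and X Xs :: "real^'m^'p" and Z Zs :: "real^'p^'n"
  assumes "C = Xs ** A + transpose Zs"
  shows "X_step A C j Z X - Xs = (X - Xs)
    + outer (- ((1 / (norm (column j A))\<^sup>2) *\<^sub>R (row j (Z - Zs) + (X - Xs) *v column j A))) (column j A)"
proof -
  \<comment> \<open>Splitting \<open>C\<close> this way cancels \<open>Xs\<close> and
    \<open>Zs\<close> in the residual and leaves only the two errors.\<close>
  have "column j C = Xs *v column j A + row j Zs"
    unfolding assms by (simp add: column_def row_def transpose_def matrix_matrix_mult_def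
        matrix_vector_mult_def vec_eq_iff)
  moreover have "row j (Z - Zs) = row j Z - row j Zs"
    by (simp add: row_def vec_eq_iff)
  ultimately have "column j C - row j Z - X *v column j A = - (row j (Z - Zs) + (X - Xs) *v column j A)"
    by (simp add: matrix_vector_mult_diff_rdistrib)
  then show ?thesis
    by (simp only: X_step_def scaleR_minus_right) simp
qed

lemma X_step_fixed:
  fixes A :: "real^'n^'m" and X Xs :: "real^'m^'p" and Z Zs :: "real^'p^'n"
  assumes "C = Xs ** A + transpose Zs" "(X - Xs) ** (A ** moore_penrose A) = X - Xs"
  shows "(X_step A C j Z X - Xs) ** (A ** moore_penrose A) = X_step A C j Z X - Xs"
proof -
  have "column j A v* (A ** moore_penrose A) = column j A"
    by (metis column_matrix_mult moore_penrose_identities transpose_matrix_vector)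
  then show ?thesis
    unfolding X_step_diff[OF assms(1)] using assms(2)
    by (simp add: matrix_add_rdistrib outer_matrix_mult)
qed

text \<open>With \<open>D = X - Xs\<close>, the new error is \<open>D (I - a a^T / |a|^2)\<close>,
  which annihilates \<open>a\<close>, minus \<open>w a^T / |a|^2\<close>. The two are orthogonal, so
  the mixed terms in \<open>w\<close> and \<open>D a\<close> drop out.\<close>

lemma X_step_error:
  fixes A :: "real^'n^'m" and X Xs :: "real^'m^'p" and Z Zs :: "real^'p^'n"
  assumes "column j A \<noteq> 0" "C = Xs ** A + transpose Zs"
  shows "(norm (column j A))\<^sup>2 * (norm (X_step A C j Z X - Xs))\<^sup>2
    = (norm (column j A))\<^sup>2 * (norm (X - Xs))\<^sup>2 + (norm (row j (Z - Zs)))\<^sup>2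
      - (norm (column j ((X - Xs) ** A)))\<^sup>2"
proof -
  define a where "a = column j A"
  define D where "D = X - Xs"
  define w where "w = row j (Z - Zs)"
  have "(norm (X_step A C j Z X - Xs))\<^sup>2 = (norm D)\<^sup>2
      - 2 * ((w + D *v a) \<bullet> (D *v a)) / (norm a)\<^sup>2 + (norm (w + D *v a) / (norm a)\<^sup>2)\<^sup>2 * (norm a)\<^sup>2"
    unfolding X_step_diff[OF assms(2)] norm_add_outer_power2 by (simp add: a_def D_def w_def)
  moreover have "(norm (w + D *v a))\<^sup>2 - 2 * ((w + D *v a) \<bullet> (D *v a)) = (norm w)\<^sup>2 - (norm (D *v a))\<^sup>2"
    unfolding power2_norm_eq_inner by (simp add: inner_add_left inner_add_right inner_commute[of "D *v a" w])
  moreover have "norm a \<noteq> 0"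
    using assms(1) by (simp add: a_def)
  ultimately have "(norm a)\<^sup>2 * (norm (X_step A C j Z X - Xs))\<^sup>2
      = (norm a)\<^sup>2 * (norm D)\<^sup>2 + (norm w)\<^sup>2 - (norm (D *v a))\<^sup>2"
    by (simp add: power_divide field_simps power2_eq_square)
  then show ?thesis
    by (simp add: column_matrix_mult a_def D_def w_def)
qed

text \<open>Summed over \<open>j\<close>, the perturbations \<open>|w|^2\<close> make up all of
  \<open>|Z - Zs|^2\<close>, and the losses \<open>|D a|^2\<close> make up \<open>|D A|^2\<close>,
  with \<open>D = X - Xs\<close>.\<close>

lemma X_step_mean_error_le:
  fixes A :: "real^'n^'m" and X Xs :: "real^'m^'p" and Z Zs :: "real^'p^'n"
  assumes "\<And>j. column j A \<noteq> 0" "A \<noteq> 0" "C = Xs ** A + transpose Zs"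
    and "(X - Xs) ** (A ** moore_penrose A) = X - Xs"
  shows "(\<Sum>j\<in>UNIV. (norm (column j A))\<^sup>2 / (norm A)\<^sup>2 * (norm (X_step A C j Z X - Xs))\<^sup>2)
    \<le> (1 - (sigma_min A)\<^sup>2 / (norm A)\<^sup>2) * (norm (X - Xs))\<^sup>2 + (norm (Z - Zs))\<^sup>2 / (norm A)\<^sup>2"
proof -
  have "(\<Sum>j\<in>UNIV. (norm (column j A))\<^sup>2 * (norm (X_step A C j Z X - Xs))\<^sup>2)
      = (norm A)\<^sup>2 * (norm (X - Xs))\<^sup>2 + (norm (Z - Zs))\<^sup>2 - (norm ((X - Xs) ** A))\<^sup>2"
    unfolding norm_matrix_power2_columns[of A] norm_matrix_power2_rows[of "Z - Zs"]
      norm_matrix_power2_columns[of "_ ** A"]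
    by (simp add: X_step_error[OF assms(1,3)] sum.distrib sum_subtractf sum_distrib_right)
  also have "\<dots> \<le> ((norm A)\<^sup>2 - (sigma_min A)\<^sup>2) * (norm (X - Xs))\<^sup>2 + (norm (Z - Zs))\<^sup>2"
    using sigma_min_le_frobenius_right[OF assms(2,4)] by (simp add: algebra_simps)
  finally have "(\<Sum>j\<in>UNIV. (norm (column j A))\<^sup>2 * (norm (X_step A C j Z X - Xs))\<^sup>2) / (norm A)\<^sup>2
      \<le> (((norm A)\<^sup>2 - (sigma_min A)\<^sup>2) * (norm (X - Xs))\<^sup>2 + (norm (Z - Zs))\<^sup>2) / (norm A)\<^sup>2"
    by (rule divide_right_mono) simp
  with assms(2) show ?thesis
    by (simp add: sum_divide_distrib field_simps)
qed

text \<open>The fixed vectors of a matrix form a subspace, and \<open>A A^+ A = A\<close> says that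
  the columns of \<open>A\<close> belong to it.\<close>

lemma matrix_pinv_fixes_span_columns:
  fixes A :: "real^'n^'m"
  assumes "x \<in> span (columns A)"
  shows "A ** moore_penrose A *v x = x"
  using assms
proof (induction rule: span_induct)
  case base
  show ?case
    by (simp add: subspace_def matrix_vector_right_distrib matrix_vector_mult_scaleR)
next
  case (step x)
  then obtain j where "x = column j A"
    by (auto simp: columns_def)
  then show ?case
    by (metis column_matrix_mult moore_penrose_identities)
qed

text \<open>The factor \<open>k\<close> in the error bound is absorbed by any rate \<open>q\<close>
  strictly above \<open>r\<close>, since \<open>k (r/q)^k\<close> tends to 0 and is therefore
  bounded.\<close>

lemma linear_times_power_le_power:
  fixes r :: real
  assumes "0 \<le> r" "r < 1"
  shows "\<exists>K q. 0 \<le> K \<and> r \<le> q \<and> q < 1 \<and> (\<forall>k. real k * r ^ k \<le> K * q ^ k)"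
proof -
  \<comment> \<open>The midpoint of \<open>r\<close> and 1 is positive even if \<open>r = 0\<close>,
    so dividing by \<open>q\<close> is safe.\<close>
  define q where "q = (1 + r) / 2"
  have q: "r < q" "q < 1" "0 < q"
    using assms by (auto simp: q_def)
  have "(\<lambda>k. real k * (r / q) ^ k) \<longlonglongrightarrow> 0"
    using assms q by (intro powser_times_n_limit_0) auto
  then have "Bseq (\<lambda>k. real k * (r / q) ^ k)"
    by (intro convergent_imp_Bseq convergentI)
  then obtain K where K: "K > 0" "\<And>k. norm (real k * (r / q) ^ k) \<le> K"
    by (auto simp: Bseq_def)
  have "real k * r ^ k \<le> K * q ^ k" for k
    using K(2)[of k] assms q by (simp add: power_divide field_simps)
  with K(1) q show ?thesis
    by (intro exI[of _ K] exI[of _ q]) auto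
qed

section \<open>Averaging over a fresh selection\<close>

text \<open>A pointwise substitute for measurability with respect to the selections in
  \<open>H\<close>. It is relative to \<open>S\<close> because the recursions are known only on
  \<open>space M\<close>.\<close>

definition depends_on :: "('i \<Rightarrow> 'w \<Rightarrow> 's) \<Rightarrow> 'i set \<Rightarrow> 'w set \<Rightarrow> ('w \<Rightarrow> 'b) \<Rightarrow> bool" where
  "depends_on Y H S f \<longleftrightarrow>
     (\<forall>\<omega>\<in>S. \<forall>\<omega>'\<in>S. (\<forall>t\<in>H. Y t \<omega> = Y t \<omega>') \<longrightarrow> f \<omega> = f \<omega>')"

text \<open>Shaped for recursions: the new value is computed from the old one together with the
  selections in the larger set.\<close>

lemma depends_on_compose:
  assumes "depends_on Y H S f" "H \<subseteq> H'"
    and "\<And>\<omega> \<omega>'. \<omega> \<in> S \<Longrightarrow> \<omega>' \<in> S \<Longrightarrow> f \<omega> = f \<omega>' \<Longrightarrow> \<forall>t\<in>H'. Y t \<omega> = Y t \<omega>' \<Longrightarrow> g \<omega> = g \<omega>'"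
  shows "depends_on Y H' S g"
  using assms unfolding depends_on_def by (meson subsetD)

text \<open>\<open>h\<close> evaluates \<open>f\<close> at a chosen outcome with the given
  selections; the choice of outcome does not affect the value.\<close>

lemma depends_on_factor:
  assumes "depends_on Y H S f"
  shows "\<exists>h. \<forall>\<omega>\<in>S. f \<omega> = h (restrict (\<lambda>t. Y t \<omega>) H)"
proof -
  define h where "h y = f (SOME \<omega>. \<omega> \<in> S \<and> restrict (\<lambda>t. Y t \<omega>) H = y)" for y
  have "f \<omega> = h (restrict (\<lambda>t. Y t \<omega>) H)" if "\<omega> \<in> S" for \<omega>
  proof -
    let ?\<omega>' = "SOME \<omega>'. \<omega>' \<in> S \<and> restrict (\<lambda>t. Y t \<omega>') H = restrict (\<lambda>t. Y t \<omega>) H"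
    have "?\<omega>' \<in> S \<and> restrict (\<lambda>t. Y t ?\<omega>') H = restrict (\<lambda>t. Y t \<omega>) H"
      by (rule someI[of _ \<omega>]) (use that in simp)
    then have "?\<omega>' \<in> S" "\<forall>t\<in>H. Y t \<omega> = Y t ?\<omega>'"
      by (auto simp: restrict_def fun_eq_iff split: if_splits)
    then have "f \<omega> = f ?\<omega>'"
      using assms that unfolding depends_on_def by blast
    then show ?thesis
      by (simp only: h_def)
  qed
  then show ?thesis by blast
qed

lemma measurable_PiM_count_space_finite:
  assumes "finite H"
  shows "(h :: _ \<Rightarrow> real) \<in> borel_measurable (PiM H (\<lambda>_. count_space (UNIV :: 's::finite set)))"
  using assms by (simp add: count_space_PiM_finite)

context prob_space
begin

text \<open>Finitely many selections with values in a finite type have finitely many joint values,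
  so \<open>f\<close> is bounded, and any function of them is measurable.\<close>

lemma depends_on_integrable:
  fixes Y :: "'i \<Rightarrow> 'a \<Rightarrow> 's::finite" and f :: "'a \<Rightarrow> real"
  assumes "\<And>t. t \<in> H \<Longrightarrow> random_variable (count_space UNIV) (Y t)" "finite H"
    and "depends_on Y H (space M) f"
  shows "integrable M f"
proof -
  obtain h where h: "\<And>\<omega>. \<omega> \<in> space M \<Longrightarrow> f \<omega> = h (restrict (\<lambda>t. Y t \<omega>) H)"
    using depends_on_factor[OF assms(3)] by blast
  have meas: "(\<lambda>\<omega>. restrict (\<lambda>t. Y t \<omega>) H) \<in> measurable M (PiM H (\<lambda>_. count_space UNIV))"
    using assms(1) by (rule measurable_restrict)
  have "finite (h ` PiE H (\<lambda>_. UNIV))"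
    using assms(2) by (intro finite_imageI finite_PiE) auto
  then obtain B where B: "\<And>y. y \<in> h ` PiE H (\<lambda>_. UNIV) \<Longrightarrow> norm y \<le> B"
    using finite_imp_bounded bounded_iff by metis
  have "integrable M (\<lambda>\<omega>. h (restrict (\<lambda>t. Y t \<omega>) H))"
  proof (rule integrable_const_bound)
    show "AE \<omega> in M. norm (h (restrict (\<lambda>t. Y t \<omega>) H)) \<le> B"
      by (intro AE_I2 B imageI) auto
    show "(\<lambda>\<omega>. h (restrict (\<lambda>t. Y t \<omega>) H)) \<in> borel_measurable M"
      using measurable_compose[OF meas measurable_PiM_count_space_finite[OF assms(2)]] .
  qed
  then show ?thesis
    by (subst Bochner_Integration.integrable_cong[OF refl h])
qed

text \<open>Conditioning on the past without conditional expectations: \<open>g (v (Y t))\<close> is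
  split by the indicators \<open>e c\<close> of the selected value, and each \<open>e c\<close> is
  independent of \<open>g c\<close> because \<open>t \<notin> H\<close>. The map \<open>v\<close>
  will strip the injection from a row or column index.\<close>

lemma expectation_fresh_selection:
  fixes Y :: "'i \<Rightarrow> 'a \<Rightarrow> 's::finite" and v :: "'s \<Rightarrow> 'c::finite" and g :: "'c \<Rightarrow> 'a \<Rightarrow> real"
  assumes indep: "indep_vars (\<lambda>_. count_space UNIV) Y UNIV"
    and H: "finite H" "t \<notin> H"
    and dep: "\<And>c. depends_on Y H (space M) (g c)"
  shows "expectation (\<lambda>\<omega>. g (v (Y t \<omega>)) \<omega>)
    = expectation (\<lambda>\<omega>. \<Sum>c\<in>UNIV. prob {\<omega> \<in> space M. v (Y t \<omega>) = c} * g c \<omega>)"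
proof -
  have rv: "random_variable (count_space UNIV) (Y i)" for i
    using indep by (simp add: indep_vars_def2)
  have int: "integrable M (g c)" for c
    using rv H(1) dep by (rule depends_on_integrable)
  define e :: "'c \<Rightarrow> 'a \<Rightarrow> real" where "e c \<omega> = indicator {c} (v (Y t \<omega>))" for c \<omega>
  have e_int: "integrable M (e c)" for c
    by (rule depends_on_integrable[of "{t}" Y]) (use rv in \<open>auto simp: depends_on_def e_def\<close>)
  have prod: "integrable M (\<lambda>\<omega>. g c \<omega> * e c \<omega>)"
      "expectation (\<lambda>\<omega>. g c \<omega> * e c \<omega>) = expectation (g c) * expectation (e c)" for c
  proof -
    obtain h where h: "\<And>\<omega>. \<omega> \<in> space M \<Longrightarrow> g c \<omega> = h (restrict (\<lambda>t. Y t \<omega>) H)"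
      using depends_on_factor[OF dep[of c]] by blast
    \<comment> \<open>The indicator is written as a function of the block \<open>{t}\<close>, so
      that independence of the disjoint blocks \<open>H\<close> and \<open>{t}\<close>
      applies.\<close>
    define k :: "('i \<Rightarrow> 's) \<Rightarrow> real" where "k y = indicator {c} (v (y t))" for y
    have "indep_var (PiM H (\<lambda>_. count_space UNIV)) (\<lambda>\<omega>. restrict (\<lambda>t. Y t \<omega>) H)
        (PiM {t} (\<lambda>_. count_space UNIV)) (\<lambda>\<omega>. restrict (\<lambda>t. Y t \<omega>) {t})"
      using H by (intro indep_var_restrict[OF indep]) auto
    then have "indep_var borel (h \<circ> (\<lambda>\<omega>. restrict (\<lambda>t. Y t \<omega>) H))
        borel (k \<circ> (\<lambda>\<omega>. restrict (\<lambda>t. Y t \<omega>) {t}))"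
      by (rule indep_var_compose) (use H in \<open>simp_all add: measurable_PiM_count_space_finite\<close>)
    moreover have "k \<circ> (\<lambda>\<omega>. restrict (\<lambda>t. Y t \<omega>) {t}) = e c"
      by (simp add: fun_eq_iff k_def e_def)
    ultimately have ind: "indep_var borel (\<lambda>\<omega>. h (restrict (\<lambda>t. Y t \<omega>) H)) borel (e c)"
      by (simp add: comp_def)
    have h_int: "integrable M (\<lambda>\<omega>. h (restrict (\<lambda>t. Y t \<omega>) H))"
      using int[of c] by (subst Bochner_Integration.integrable_cong[OF refl h[symmetric]])
    have gh: "g c \<omega> * e c \<omega> = h (restrict (\<lambda>t. Y t \<omega>) H) * e c \<omega>" if "\<omega> \<in> space M" for \<omega>
      using h[OF that] by simp
    show "integrable M (\<lambda>\<omega>. g c \<omega> * e c \<omega>)"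
      using indep_var_integrable[OF ind h_int e_int]
      by (subst Bochner_Integration.integrable_cong[OF refl gh])
    show "expectation (\<lambda>\<omega>. g c \<omega> * e c \<omega>) = expectation (g c) * expectation (e c)"
      using indep_var_lebesgue_integral[OF ind h_int e_int]
        Bochner_Integration.integral_cong[OF refl h, of M]
        Bochner_Integration.integral_cong[OF refl gh, of M]
      by simp
  qed
  have "expectation (e c) = prob {\<omega> \<in> space M. v (Y t \<omega>) = c}" for c
  proof -
    have "expectation (e c) = expectation (indicator {\<omega> \<in> space M. v (Y t \<omega>) = c})"
      by (rule Bochner_Integration.integral_cong) (auto simp: e_def indicator_def)
    then show ?thesis
      by (simp add: Int_absorb2 subset_iff)
  qed
  moreover have "g (v (Y t \<omega>)) \<omega> = (\<Sum>c\<in>UNIV. g c \<omega> * e c \<omega>)" for \<omega>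
    by (simp add: e_def indicator_def)
  ultimately show ?thesis
    using int prod by (simp add: mult.commute)
qed

end

section \<open>Coupled error recursions and the resulting rate\<close>

theorem theorem4p4:
  fixes A :: "real^'n^'m"
    and C :: "real^'n^'p"
    and M :: "'w measure"
    and I :: "nat \<Rightarrow> 'w \<Rightarrow> 'm"
    and J :: "nat \<Rightarrow> 'w \<Rightarrow> 'n"
    and X0 :: "real^'m^'p"
    and Z0 :: "real^'p^'n"
    and X :: "nat \<Rightarrow> 'w \<Rightarrow> real^'m^'p"
    and Z :: "nat \<Rightarrow> 'w \<Rightarrow> real^'p^'n"
    and \<rho> :: real
  assumes no_zero_row: "\<And>i. row i A \<noteq> 0"
    and no_zero_column: "\<And>j. column j A \<noteq> 0"
    and X0: "\<And>i. row i X0 \<in> span (columns A)"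
    and Z0: "Z0 = transpose C"
    and M: "prob_space M"
    and indep: "independent_selections M I J"
    and prob_I: "\<And>k i. measure M {\<omega> \<in> space M. I k \<omega> = i} = (norm (row i A))\<^sup>2 / (norm A)\<^sup>2"
    and prob_J: "\<And>k j. measure M {\<omega> \<in> space M. J k \<omega> = j} = (norm (column j A))\<^sup>2 / (norm A)\<^sup>2"
    and Z_0: "\<And>\<omega>. \<omega> \<in> space M \<Longrightarrow> Z 0 \<omega> = Z0"
    and X_0: "\<And>\<omega>. \<omega> \<in> space M \<Longrightarrow> X 0 \<omega> = X0"
    and Z_Suc: "\<And>k \<omega>. \<omega> \<in> space M \<Longrightarrow> Z (Suc k) \<omega> = Z_step A (I k \<omega>) (Z k \<omega>)"
    and X_Suc: "\<And>k \<omega>. \<omega> \<in> space M \<Longrightarrow>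
                  X (Suc k) \<omega> = X_step A C (J k \<omega>) (Z (Suc k) \<omega>) (X k \<omega>)"
    and \<rho>: "\<rho> = 1 - (sigma_min A)\<^sup>2 / (norm A)\<^sup>2"
  shows "converges_linearly_in_mean_square M X (C ** moore_penrose A) \<and>
    (\<forall>k. prob_space.expectation M (\<lambda>\<omega>. (norm (X k \<omega> - C ** moore_penrose A))\<^sup>2)
       \<le> real k * \<rho> ^ k / (norm A)\<^sup>2
             * (norm (Z0 - (mat 1 - moore_penrose A ** A) ** transpose C))\<^sup>2
         + \<rho> ^ k * (norm (X0 - C ** moore_penrose A))\<^sup>2)"
proof -
  interpret prob_space M by (rule M)
  have pinv: "A ** moore_penrose A ** A = A" "moore_penrose A ** A ** moore_penrose A = moore_penrose A"
      "transpose (A ** moore_penrose A) = A ** moore_penrose A"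
      "transpose (moore_penrose A ** A) = moore_penrose A ** A"
    using moore_penrose_identities[of A] by auto
  have "A \<noteq> 0"
    using no_zero_row by (auto simp: row_def vec_eq_iff)
  have "\<rho> < 1"
    using sigma_min_characterization(1)[OF \<open>A \<noteq> 0\<close>] \<open>A \<noteq> 0\<close> by (simp add: \<rho>)
  have "0 \<le> \<rho>"
    unfolding \<rho> using no_zero_row \<open>A \<noteq> 0\<close> by (rule sigma_min_le_norm)
  define Xs where "Xs = C ** moore_penrose A"
  \<comment> \<open>The columns of \<open>C^T\<close> projected onto the kernel of \<open>A\<close>:
    the transposed residual of the possibly inconsistent \<open>X A = C\<close>.\<close>
  define Zs where "Zs = (mat 1 - moore_penrose A ** A) ** transpose C"
  have AZs: "A ** Zs = 0"
    by (simp add: Zs_def matrix_mul_assoc matrix_diff_ldistrib pinv)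
  have "transpose Zs = transpose (transpose C) - transpose (moore_penrose A ** A ** transpose C)"
    by (simp add: Zs_def matrix_diff_rdistrib transpose_def vec_eq_iff)
  then have "transpose Zs = C - C ** (moore_penrose A ** A)"
    by (simp only: matrix_transpose_mul[of "moore_penrose A ** A"] pinv transpose_transpose)
  then have C_split: "C = Xs ** A + transpose Zs"
    by (simp add: Xs_def matrix_mul_assoc)
  have Z_fixed: "moore_penrose A ** A ** (Z k \<omega> - Zs) = Z k \<omega> - Zs" if "\<omega> \<in> space M" for k \<omega>
  proof (induction k)
    case 0
    \<comment> \<open>Starting at \<open>C^T\<close> puts the initial error into the row
      space.\<close>
    have "Z0 - Zs = moore_penrose A ** A ** transpose C"
      by (simp add: Z0 Zs_def matrix_diff_rdistrib)
    then show ?case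
      using pinv by (simp add: Z_0[OF that] matrix_mul_assoc)
  next
    case (Suc k)
    then show ?case
      by (simp add: Z_Suc[OF that] Z_step_fixed)
  qed
  have X_fixed: "(X k \<omega> - Xs) ** (A ** moore_penrose A) = X k \<omega> - Xs" if "\<omega> \<in> space M" for k \<omega>
  proof (induction k)
    case 0
    have "row i (X0 ** (A ** moore_penrose A)) = row i X0" for i
      by (metis matrix_pinv_fixes_span_columns[OF X0] pinv(3) row_matrix_mult transpose_matrix_vector)
    then have "X0 ** (A ** moore_penrose A) = X0"
      by (simp add: row_def vec_eq_iff)
    moreover have "Xs ** (A ** moore_penrose A) = Xs"
      using pinv by (metis Xs_def matrix_mul_assoc)
    ultimately show ?case
      by (simp add: X_0[OF that] matrix_diff_rdistrib)
  next
    case (Suc k)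
    then show ?case
      by (simp add: X_Suc[OF that] X_step_fixed[OF C_split])
  qed
  define Y where "Y = case_sum (\<lambda>k \<omega>. Inl (I k \<omega>)) (\<lambda>k \<omega>. Inr (J k \<omega>) :: 'm + 'n)"
  have Y_indep: "indep_vars (\<lambda>_. count_space UNIV) Y UNIV"
    using indep by (simp add: independent_selections_def Y_def)
  then have Y_rv: "random_variable (count_space UNIV) (Y t)" for t
    by (simp add: indep_vars_def2)
  \<comment> \<open>The selections of iterations \<open>0\<close> to \<open>k - 1\<close>, which
    determine the \<open>k\<close>-th iterates; \<open>Inl k\<close> and \<open>Inr k\<close> are
    still fresh.\<close>
  define H where "H k = (Inl ` {..<k} \<union> Inr ` {..<k} :: (nat + nat) set)" for k
  have H_finite: "finite (H k)" for k
    by (simp add: H_def)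
  have H_Suc: "H (Suc k) = insert (Inl k) (insert (Inr k) (H k))" for k
    by (auto simp: H_def lessThan_Suc)
  \<comment> \<open>The pair is carried through the induction because the update of \<open>X\<close>
    reads \<open>Z\<close>.\<close>
  have dep: "depends_on Y (H k) (space M) (\<lambda>\<omega>. (Z k \<omega>, X k \<omega>))" for k
  proof (induction k)
    case 0
    show ?case
      by (simp add: depends_on_def Z_0 X_0)
  next
    case (Suc k)
    then show ?case
      by (rule depends_on_compose) (auto simp: H_Suc Y_def Z_Suc X_Suc)
  qed
  define zerr where "zerr k = expectation (\<lambda>\<omega>. (norm (Z k \<omega> - Zs))\<^sup>2)" for k
  define xerr where "xerr k = expectation (\<lambda>\<omega>. (norm (X k \<omega> - Xs))\<^sup>2)" for k
  have Z_int: "integrable M (\<lambda>\<omega>. (norm (Z k \<omega> - Zs))\<^sup>2)" for k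
    by (rule depends_on_integrable[OF Y_rv H_finite depends_on_compose[OF dep[of k]]]) auto
  have X_int: "integrable M (\<lambda>\<omega>. (norm (X k \<omega> - Xs))\<^sup>2)" for k
    by (rule depends_on_integrable[OF Y_rv H_finite depends_on_compose[OF dep[of k]]]) auto
  have zerr_Suc: "zerr (Suc k) \<le> \<rho> * zerr k" for k
  proof -
    define g where "g i \<omega> = (norm (Z_step A i (Z k \<omega>) - Zs))\<^sup>2" for i \<omega>
    have g_dep: "depends_on Y (H k) (space M) (g i)" for i
      by (rule depends_on_compose[OF dep[of k]]) (auto simp: g_def)
    have "zerr (Suc k) = expectation (\<lambda>\<omega>. g (projl (Y (Inl k) \<omega>)) \<omega>)"
      unfolding zerr_def by (rule Bochner_Integration.integral_cong) (simp_all add: g_def Y_def Z_Suc)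
    also have "\<dots> = expectation (\<lambda>\<omega>. \<Sum>i\<in>UNIV. prob {\<omega> \<in> space M. projl (Y (Inl k) \<omega>) = i} * g i \<omega>)"
      by (rule expectation_fresh_selection[OF Y_indep H_finite _ g_dep]) (auto simp: H_def)
    also have "\<dots> \<le> expectation (\<lambda>\<omega>. \<rho> * (norm (Z k \<omega> - Zs))\<^sup>2)"
    proof (rule integral_mono)
      show "integrable M (\<lambda>\<omega>. \<Sum>i\<in>UNIV. prob {\<omega> \<in> space M. projl (Y (Inl k) \<omega>) = i} * g i \<omega>)"
        using depends_on_integrable[OF Y_rv H_finite g_dep] by simp
      show "integrable M (\<lambda>\<omega>. \<rho> * (norm (Z k \<omega> - Zs))\<^sup>2)"
        using Z_int by simp
      show "(\<Sum>i\<in>UNIV. prob {\<omega> \<in> space M. projl (Y (Inl k) \<omega>) = i} * g i \<omega>)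
          \<le> \<rho> * (norm (Z k \<omega> - Zs))\<^sup>2" if "\<omega> \<in> space M" for \<omega>
        using Z_step_mean_error_le[OF no_zero_row \<open>A \<noteq> 0\<close> AZs Z_fixed[OF that, of k]]
        by (simp add: Y_def g_def prob_I \<rho>)
    qed
    finally show ?thesis
      by (simp add: zerr_def)
  qed
  have xerr_Suc: "xerr (Suc k) \<le> \<rho> * xerr k + zerr (Suc k) / (norm A)\<^sup>2" for k
  proof -
    define g where "g j \<omega> = (norm (X_step A C j (Z (Suc k) \<omega>) (X k \<omega>) - Xs))\<^sup>2" for j \<omega>
    \<comment> \<open>The column step uses the updated \<open>Z (Suc k)\<close>, so the current row
      choice joins the past; the column choice \<open>Inr k\<close> remains outside.\<close>
    have g_dep: "depends_on Y (insert (Inl k) (H k)) (space M) (g j)" for j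
      by (rule depends_on_compose[OF dep[of k]]) (auto simp: g_def Z_Suc Y_def)
    have fin: "finite (insert (Inl k) (H k))"
      using H_finite by simp
    have "xerr (Suc k) = expectation (\<lambda>\<omega>. g (projr (Y (Inr k) \<omega>)) \<omega>)"
      unfolding xerr_def by (rule Bochner_Integration.integral_cong) (simp_all add: g_def Y_def X_Suc)
    also have "\<dots> = expectation (\<lambda>\<omega>. \<Sum>j\<in>UNIV. prob {\<omega> \<in> space M. projr (Y (Inr k) \<omega>) = j} * g j \<omega>)"
      by (rule expectation_fresh_selection[OF Y_indep fin _ g_dep]) (auto simp: H_def)
    also have "\<dots> \<le> expectation (\<lambda>\<omega>. \<rho> * (norm (X k \<omega> - Xs))\<^sup>2 + (norm (Z (Suc k) \<omega> - Zs))\<^sup>2 / (norm A)\<^sup>2)"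
    proof (rule integral_mono)
      show "integrable M (\<lambda>\<omega>. \<Sum>j\<in>UNIV. prob {\<omega> \<in> space M. projr (Y (Inr k) \<omega>) = j} * g j \<omega>)"
        using depends_on_integrable[OF Y_rv fin g_dep] by simp
      show "integrable M (\<lambda>\<omega>. \<rho> * (norm (X k \<omega> - Xs))\<^sup>2 + (norm (Z (Suc k) \<omega> - Zs))\<^sup>2 / (norm A)\<^sup>2)"
        using X_int Z_int by simp
      show "(\<Sum>j\<in>UNIV. prob {\<omega> \<in> space M. projr (Y (Inr k) \<omega>) = j} * g j \<omega>)
          \<le> \<rho> * (norm (X k \<omega> - Xs))\<^sup>2 + (norm (Z (Suc k) \<omega> - Zs))\<^sup>2 / (norm A)\<^sup>2"
        if "\<omega> \<in> space M" for \<omega>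
        using X_step_mean_error_le[OF no_zero_column \<open>A \<noteq> 0\<close> C_split X_fixed[OF that, of k],
            of "Z (Suc k) \<omega>"]
        by (simp add: Y_def g_def prob_J \<rho>)
    qed
    also have "\<dots> = \<rho> * xerr k + zerr (Suc k) / (norm A)\<^sup>2"
      using X_int Z_int by (simp add: xerr_def zerr_def)
    finally show ?thesis .
  qed
  have zerr_le: "zerr k \<le> \<rho> ^ k * (norm (Z0 - Zs))\<^sup>2" for k
  proof (induction k)
    case 0
    have "zerr 0 = expectation (\<lambda>\<omega>. (norm (Z0 - Zs))\<^sup>2)"
      unfolding zerr_def by (rule Bochner_Integration.integral_cong) (simp_all add: Z_0)
    then show ?case
      by (simp add: prob_space)
  next
    case (Suc k)
    have "\<rho> * zerr k \<le> \<rho> * (\<rho> ^ k * (norm (Z0 - Zs))\<^sup>2)"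
      using Suc \<open>0 \<le> \<rho>\<close> by (rule mult_left_mono)
    with zerr_Suc[of k] show ?case
      by (simp add: mult.assoc)
  qed
  have xerr_le: "xerr k \<le> real k * \<rho> ^ k / (norm A)\<^sup>2 * (norm (Z0 - Zs))\<^sup>2 + \<rho> ^ k * (norm (X0 - Xs))\<^sup>2" for k
  proof (induction k)
    case 0
    have "xerr 0 = expectation (\<lambda>\<omega>. (norm (X0 - Xs))\<^sup>2)"
      unfolding xerr_def by (rule Bochner_Integration.integral_cong) (simp_all add: X_0)
    then show ?case
      by (simp add: prob_space)
  next
    case (Suc k)
    have "xerr (Suc k) \<le> \<rho> * xerr k + zerr (Suc k) / (norm A)\<^sup>2"
      by (rule xerr_Suc)
    \<comment> \<open>The new perturbation comes from \<open>zerr (Suc k)\<close> and so carries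
      \<open>\<rho> ^ Suc k\<close>, the power that the \<open>k\<close> earlier contributions reach
      after one more contraction; this produces the factor \<open>Suc k\<close>.\<close>
    also have "\<dots> \<le> \<rho> * (real k * \<rho> ^ k / (norm A)\<^sup>2 * (norm (Z0 - Zs))\<^sup>2 + \<rho> ^ k * (norm (X0 - Xs))\<^sup>2)
        + \<rho> ^ Suc k * (norm (Z0 - Zs))\<^sup>2 / (norm A)\<^sup>2"
      by (intro add_mono mult_left_mono divide_right_mono Suc zerr_le \<open>0 \<le> \<rho>\<close>) auto
    also have "\<dots> = real (Suc k) * \<rho> ^ Suc k / (norm A)\<^sup>2 * (norm (Z0 - Zs))\<^sup>2
        + \<rho> ^ Suc k * (norm (X0 - Xs))\<^sup>2"
      using \<open>A \<noteq> 0\<close> by (simp add: field_simps)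
    finally show ?case .
  qed
  obtain K q where K: "0 \<le> K" "\<rho> \<le> q" "q < 1" "\<And>k. real k * \<rho> ^ k \<le> K * q ^ k"
    using linear_times_power_le_power[OF \<open>0 \<le> \<rho>\<close> \<open>\<rho> < 1\<close>] by blast
  \<comment> \<open>\<open>K\<close> absorbs the factor \<open>k\<close> of the first summand; the
    second only needs \<open>\<rho> \<le> q\<close>.\<close>
  define c where "c = K * ((norm (Z0 - Zs))\<^sup>2 / (norm A)\<^sup>2) + (norm (X0 - Xs))\<^sup>2"
  have "xerr k \<le> c * q ^ k" for k
  proof -
    have "xerr k \<le> (real k * \<rho> ^ k) * ((norm (Z0 - Zs))\<^sup>2 / (norm A)\<^sup>2) + \<rho> ^ k * (norm (X0 - Xs))\<^sup>2"
      using xerr_le[of k] by simp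
    also have "\<dots> \<le> (K * q ^ k) * ((norm (Z0 - Zs))\<^sup>2 / (norm A)\<^sup>2) + q ^ k * (norm (X0 - Xs))\<^sup>2"
      using K \<open>0 \<le> \<rho>\<close> by (intro add_mono mult_right_mono power_mono) auto
    finally show ?thesis
      by (simp add: c_def algebra_simps)
  qed
  moreover have "0 \<le> c" "0 \<le> q"
    using K \<open>0 \<le> \<rho>\<close> by (auto simp: c_def)
  ultimately have "converges_linearly_in_mean_square M X Xs"
    using X_int \<open>q < 1\<close> unfolding converges_linearly_in_mean_square_def xerr_def by blast
  with xerr_le show ?thesis
    unfolding xerr_def Xs_def Zs_def by blast
qed

end
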